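(* (SMDCT V) Let $n,N$ be positive integers. For all $k,k'\in D_N^+$, $$\sum_{s\in F_N^{\mathrm{V},+}}\varepsilon_s H_s^{-1}\cos_k^+(s)\cos_{k'}^+(s)=\frac{H_k}{d_k}\left(\frac{2N-1}{4}\right)^n\delta_{kk'}.$$ Consequently any function $f:F_N^{\mathrm{V},+}\to\mathbb{R}$ can be expanded, for all $s\in F_N^{\mathrm{V},+}$, as $$f(s)=\sum_{k\in D_N^+}A_k\cos^+_k(s)\quad\text{with}\quad A_k=\frac{d_k}{H_k}\left(\frac{4}{2N-1}\right)^n\sum_{s\in F_N^{\mathrm{V},+}}\varepsilon_s H_s^{-1}f(s)\cos_k^+(s).$$
   Context: For $\lambda,x\in\mathbb{R}^n$, the symmetric cosine function is $\cos^+_\lambda(x)=\sum_{\sigma\in S_n}\prod_{i=1}^n\cos(\pi\lambda_{\sigma(i)}x_i)$. For $y\in\mathbb{R}^n$, $H_y=\#\{\sigma\in S_n : \sigma(y)=y\}$ is the order of the stabilizer of $y$, where $\sigma(y)=(y_{\sigma(1)},\dots,y_{\sigma(n)})$. For fixed $N$, put $c_r=\frac12$ if $r=0$ or $r=N$, and $c_r=1$ otherwise. Let $D_N=\{(k_1,\dots,k_n)\in\mathbb{Z}^n : 0\le k_i\le N-1,\ i=1,\dots,n\}$ and $D_N^+=\{k\in D_N : k_1\ge k_2\ge\dots\ge k_n\}$. For $k\in D_N$, $d_k=c_{k_1}\cdots c_{k_n}$. The grid is $F_N^{\mathrm{V},+}=\left\{\left(\frac{2r_1}{2N-1},\dots,\frac{2r_n}{2N-1}\right)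 : (r_1,\dots,r_n)\in D_N^+\right\}$, and for $s=\left(\frac{2r_1}{2N-1},\dots,\frac{2r_n}{2N-1}\right)$ in it, $\varepsilon_s=c_{r_1}\cdots c_{r_n}$. *)

theory Defs
  imports "HOL-Analysis.Analysis" "HOL-Combinatorics.Permutations"
begin

text \<open>
  The dimension is \<open>n = CARD('n)\<close>. The index type carries a linear order so that the
  monotonicity condition \<open>k\<^sub>1 \<ge> \<dots> \<ge> k\<^sub>n\<close> makes sense; the group \<open>S\<^sub>n\<close> consists of
  the permutations of \<open>UNIV :: 'n set\<close>.
\<close>

definition cos_plus :: "real ^ 'n \<Rightarrow> real ^ 'n \<Rightarrow> real" where
  "cos_plus l x = (\<Sum>\<sigma> | \<sigma> permutes UNIV. \<Prod>i\<in>UNIV. cos (pi * l $ \<sigma> i * x $ i))"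

definition stab_order :: "real ^ 'n \<Rightarrow> nat" where
  "stab_order y = card {\<sigma>. \<sigma> permutes UNIV \<and> (\<chi> i. y $ \<sigma> i) = y}"

definition real_vec :: "int ^ 'n \<Rightarrow> real ^ 'n" where
  "real_vec k = (\<chi> i. real_of_int (k $ i))"

definition c_weight :: "nat \<Rightarrow> int \<Rightarrow> real" where
  "c_weight N r = (if r = 0 \<or> r = int N then 1 / 2 else 1)"

definition d_weight :: "nat \<Rightarrow> int ^ 'n \<Rightarrow> real" where
  "d_weight N k = (\<Prod>i\<in>UNIV. c_weight N (k $ i))"

definition D_set :: "nat \<Rightarrow> (int ^ 'n) set" where
  "D_set N = {k. \<forall>i. 0 \<le> k $ i \<and> k $ i \<le> int N - 1}"

definition D_plus :: "nat \<Rightarrow> (int ^ 'n::{finite,linorder}) set" where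
  "D_plus N = {k \<in> D_set N. \<forall>i j. i \<le> j \<longrightarrow> k $ i \<ge> k $ j}"

definition grid_point :: "nat \<Rightarrow> int ^ 'n \<Rightarrow> real ^ 'n" where
  "grid_point N r = (\<chi> i. 2 * real_of_int (r $ i) / (2 * real N - 1))"

definition F_plus :: "nat \<Rightarrow> (real ^ 'n::{finite,linorder}) set" where
  "F_plus N = grid_point N ` D_plus N"

lemma inj_grid_point: "inj (grid_point N)"
proof (rule injI)
  fix r r' :: "int ^ 'n"
  assume eq: "grid_point N r = grid_point N r'"
  have "2 * int N \<noteq> 1" by presburger
  then have "real_of_int (2 * int N) \<noteq> real_of_int 1" by (simp only: of_int_eq_iff not_False_eq_True)
  then have "2 * real N - 1 \<noteq> 0" by simp
  with eq show "r = r'" by (simp add: grid_point_def vec_eq_iff)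
qed

text \<open>
  The weight of a grid point \<open>s\<close> is read off from its index vector \<open>r\<close>, which is unique
  because \<open>grid_point N\<close> is injective.
\<close>

definition eps_weight :: "nat \<Rightarrow> real ^ 'n::{finite,linorder} \<Rightarrow> real" where
  "eps_weight N s = d_weight N (THE r. r \<in> D_plus N \<and> s = grid_point N r)"

lemma eps_weight_grid_point:
  "r \<in> D_plus N \<Longrightarrow> eps_weight N (grid_point N r) = (\<Prod>i\<in>UNIV. c_weight N (r $ i))"
  unfolding eps_weight_def d_weight_def[symmetric]
  by (rule arg_cong[where f = "d_weight N"], rule the_equality)
    (auto dest: injD[OF inj_grid_point])

definition expansion_coeff ::
    "nat \<Rightarrow> (real ^ 'n::{finite,linorder} \<Rightarrow> real) \<Rightarrow> int ^ 'n::{finite,linorder} \<Rightarrow> real" where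
  "expansion_coeff N f k =
     d_weight N k / real (stab_order (real_vec k)) * (4 / (2 * real N - 1)) ^ CARD('n) *
     (\<Sum>s\<in>F_plus N. eps_weight N s * inverse (real (stab_order s)) * f s * cos_plus (real_vec k) s)"

end

theory Submission
  imports Defs
begin

text \<open>
  In dimension one, the functions \<open>r \<mapsto> cos (2 \<pi> k r / (2 N - 1))\<close> with
  \<open>0 \<le> k < N\<close> are orthogonal on \<open>{0, \<dots>, N - 1}\<close> for the weight that halves the
  node \<open>0\<close>: a product of two cosines is half a sum of two cosines, and a cosine of nonzero
  frequency sums to a value of the Dirichlet kernel at a zero of its numerator (\<open>dct_kernel_orthogonal\<close>).

  On the full cube \<open>D_set N\<close>, sums of products over coordinates factor, so products of
  one-dimensional kernels are orthogonal as well (\<open>prod_kernel_orthogonal\<close>). Expanding the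
  product of two symmetrized kernels over pairs of permutations \<open>\<sigma>, \<tau>\<close>, only the pairs with
  \<open>k \<circ> \<sigma> = l \<circ> \<tau>\<close> survive. For decreasing \<open>k\<close> and \<open>l\<close> there are none unless
  \<open>k = l\<close>, in which case every \<open>\<tau>\<close> has \<open>H\<^sub>k\<close> partners.

  The cube is the union of the orbits of decreasing vectors, and by orbit-stabilizer the orbit of
  \<open>r\<close> has \<open>n! / H\<^sub>r\<close> elements. A symmetric function thus has as its sum over the cube
  \<open>n!\<close> times its sum over decreasing vectors weighted by \<open>1 / H\<^sub>r\<close>
  (\<open>sum_D_set_symmetric\<close>); this turns orthogonality on the cube into
  \<open>sym_kernel_orthogonal\<close>.

  For the expansion, completeness needs no separate argument. Frequencies and grid nodes are
  indexed by the same set, with the same weights, and the kernel is symmetric in the two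
  indices (\<open>sym_kernel_commute\<close>). The dual orthogonality relation, summing over frequencies
  at two fixed nodes, is therefore the same relation, and substituting it into the right-hand
  side of the expansion leaves \<open>f s\<close>.
\<close>

section \<open>One dimension\<close>

text \<open>
  Multiplying by \<open>2 sin (t / 2)\<close> makes the sum telescope; keeping the sine on the left
  avoids a hypothesis on \<open>t\<close>.
\<close>

lemma dirichlet_kernel:
  fixes t :: real
  shows "2 * sin (t / 2) * (1 / 2 + (\<Sum>r=1..m. cos (real r * t))) = sin ((2 * real m + 1) * t / 2)"
proof (induction m)
  case 0
  then show ?case by simp
next
  case (Suc m)
  have "2 * sin (t / 2) * cos (real (Suc m) * t)
      = sin (t / 2 + real (Suc m) * t) + sin (t / 2 - real (Suc m) * t)"
    by (simp add: sin_add sin_diff)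
  also have "t / 2 + real (Suc m) * t = (2 * real (Suc m) + 1) * t / 2"
    by (simp add: field_simps)
  also have "t / 2 - real (Suc m) * t = - ((2 * real m + 1) * t / 2)"
    by (simp add: field_simps)
  finally have "2 * sin (t / 2) * cos (real (Suc m) * t)
      = sin ((2 * real (Suc m) + 1) * t / 2) - sin ((2 * real m + 1) * t / 2)"
    by simp
  with Suc.IH show ?case by (simp add: distrib_left del: of_nat_Suc)
qed

text \<open>
  This is \<open>cos (\<pi> a x)\<close> at the node \<open>x = 2 b / (2 N - 1)\<close>. The node is represented by its
  index \<open>b\<close> because the symmetry between \<open>a\<close> and \<open>b\<close> yields the inversion formula.
\<close>

definition dct_kernel :: "nat \<Rightarrow> int \<Rightarrow> int \<Rightarrow> real" where
  "dct_kernel N a b = cos (2 * pi * of_int a * of_int b / (2 * real N - 1))"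

lemma dct_kernel_commute: "dct_kernel N a b = dct_kernel N b a"
  by (simp add: dct_kernel_def mult_ac)

text \<open>
  With \<open>t = 2 \<pi> m / (2 N - 1)\<close> the weighted sum is the one in \<open>dirichlet_kernel\<close>, whose
  right-hand side becomes \<open>sin (\<pi> m) = 0\<close>. The bound on \<open>m\<close> makes \<open>0\<close> the only
  multiple of \<open>2 N - 1\<close> in range, so that \<open>sin (t / 2)\<close> can be cancelled otherwise.
\<close>

lemma sum_weight_dct_kernel:
  assumes N: "N > 0" and m: "\<bar>m\<bar> < 2 * int N - 1"
  shows "(\<Sum>r\<in>{0..int N - 1}. c_weight N r * dct_kernel N m r)
    = (if m = 0 then (2 * real N - 1) / 2 else 0)"
proof -
  define t where "t = 2 * pi * of_int m / (2 * real N - 1)"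
  have pos: "2 * real N - 1 > 0" using N by linarith
  have "{0..int N - 1} = int ` {0..N - 1}"
    using N by (simp add: image_int_atLeastAtMost of_nat_diff)
  then have "(\<Sum>r\<in>{0..int N - 1}. c_weight N r * dct_kernel N m r)
      = (\<Sum>r\<in>{0..N - 1}. c_weight N (int r) * dct_kernel N m (int r))"
    by (simp add: sum.reindex)
  also have "\<dots> = c_weight N 0 * dct_kernel N m 0
      + (\<Sum>r\<in>{1..N - 1}. c_weight N (int r) * dct_kernel N m (int r))"
    by (subst sum.atLeast_Suc_atMost) auto
  also have "(\<Sum>r\<in>{1..N - 1}. c_weight N (int r) * dct_kernel N m (int r))
      = (\<Sum>r\<in>{1..N - 1}. cos (real r * t))"
    by (rule sum.cong) (use N in \<open>auto simp: c_weight_def dct_kernel_def t_def mult_ac\<close>)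
  also have "c_weight N 0 * dct_kernel N m 0 = 1 / 2"
    by (simp add: c_weight_def dct_kernel_def)
  finally have eq: "(\<Sum>r\<in>{0..int N - 1}. c_weight N r * dct_kernel N m r)
      = 1 / 2 + (\<Sum>r=1..N - 1. cos (real r * t))" .
  show ?thesis
  proof (cases "m = 0")
    case True
    then show ?thesis unfolding eq using N by (simp add: t_def of_nat_diff)
  next
    case False
    have half: "t / 2 = pi * (of_int m / (2 * real N - 1))"
      using pos by (simp add: t_def field_simps)
    have "sin (t / 2) \<noteq> 0"
    proof
      assume "sin (t / 2) = 0"
      then obtain i :: int where "t / 2 = of_int i * pi"
        by (auto simp: sin_zero_iff_int2)
      then have "pi * (of_int m / (2 * real N - 1)) = pi * of_int i"
        using half by simp
      then have "of_int m / (2 * real N - 1) = (of_int i :: real)"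
        using mult_left_cancel[OF pi_neq_zero] by blast
      then have "of_int m = (of_int i :: real) * (2 * real N - 1)"
        using pos by (simp add: field_simps)
      also have "\<dots> = of_int (i * (2 * int N - 1))" by simp
      finally have mi: "m = i * (2 * int N - 1)" by (simp only: of_int_eq_iff)
      with False have "\<bar>i\<bar> \<ge> 1" by auto
      then have "1 * (2 * int N - 1) \<le> \<bar>i\<bar> * \<bar>2 * int N - 1\<bar>"
        using N by (intro mult_mono) auto
      then have "\<bar>m\<bar> \<ge> 2 * int N - 1" using mi by (simp add: abs_mult)
      with m show False by simp
    qed
    moreover have "sin ((2 * real (N - 1) + 1) * t / 2) = 0"
    proof -
      have "(2 * real (N - 1) + 1) * t / 2 = of_int m * pi"
        using N pos by (simp add: t_def of_nat_diff field_simps)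
      then show ?thesis by (simp add: sin_zero_iff_int2)
    qed
    ultimately show ?thesis
      using dirichlet_kernel[of t "N - 1"] eq False by simp
  qed
qed

text \<open>
  The sum and the difference of two frequencies are both smaller than \<open>2 N - 1\<close> in absolute
  value. The sum vanishes only for \<open>k = l = 0\<close>, where it doubles the value; the factor
  \<open>1 / c_weight N k\<close> records exactly this.
\<close>

lemma dct_kernel_orthogonal:
  assumes N: "N > 0" and k: "k \<in> {0..int N - 1}" and l: "l \<in> {0..int N - 1}"
  shows "(\<Sum>r\<in>{0..int N - 1}. c_weight N r * (dct_kernel N k r * dct_kernel N l r))
    = (if k = l then (2 * real N - 1) / 4 / c_weight N k else 0)"
proof -
  have prod: "dct_kernel N k r * dct_kernel N l r
      = (dct_kernel N (k - l) r + dct_kernel N (k + l) r) / 2" for r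
    unfolding dct_kernel_def
    by (simp add: cos_times_cos ring_distribs diff_divide_distrib add_divide_distrib)
  have "(\<Sum>r\<in>{0..int N - 1}. c_weight N r * (dct_kernel N k r * dct_kernel N l r))
      = ((\<Sum>r\<in>{0..int N - 1}. c_weight N r * dct_kernel N (k - l) r)
        + (\<Sum>r\<in>{0..int N - 1}. c_weight N r * dct_kernel N (k + l) r)) / 2"
    unfolding prod by (simp add: sum.distrib[symmetric] sum_divide_distrib ring_distribs)
  also have "\<dots> = ((if k = l then (2 * real N - 1) / 2 else 0)
      + (if k + l = 0 then (2 * real N - 1) / 2 else 0)) / 2"
    using k l by (simp add: sum_weight_dct_kernel[OF N] abs_if)
  also have "\<dots> = (if k = l then (2 * real N - 1) / 4 / c_weight N k else 0)"
    using k l by (auto simp: c_weight_def)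
  finally show ?thesis .
qed

section \<open>Permuted vectors and their decreasing representatives\<close>

definition perm_vec :: "'a ^ 'n \<Rightarrow> ('n \<Rightarrow> 'n) \<Rightarrow> 'a ^ 'n" where
  "perm_vec y \<sigma> = (\<chi> i. y $ \<sigma> i)"

lemma perm_vec_nth [simp]: "perm_vec y \<sigma> $ i = y $ \<sigma> i"
  by (simp add: perm_vec_def)

lemma perm_vec_comp: "perm_vec y (\<sigma> \<circ> \<tau>) = perm_vec (perm_vec y \<sigma>) \<tau>"
  by (simp add: vec_eq_iff)

lemma perm_vec_inv:
  assumes "\<sigma> permutes UNIV"
  shows "perm_vec y \<sigma> = z \<longleftrightarrow> y = perm_vec z (inv \<sigma>)"
  using permutes_inverses[OF assms] by (auto simp: vec_eq_iff) metis

text \<open>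
  Sorting. The induction compares two arbitrary index sets of equal size, because removing the
  largest position from one and the index of the smallest entry from the other leaves different
  sets.
\<close>

lemma ex_perm_decreasing:
  fixes y :: "'a::linorder ^ 'n::{finite,linorder}"
  shows "\<exists>\<sigma>. \<sigma> permutes UNIV \<and> (\<forall>i j. i \<le> j \<longrightarrow> y $ \<sigma> j \<le> y $ \<sigma> i)"
proof -
  have "\<exists>\<sigma>. bij_betw \<sigma> A B \<and> (\<forall>i\<in>A. \<forall>j\<in>A. i \<le> j \<longrightarrow> y $ \<sigma> j \<le> y $ \<sigma> i)"
    if "card A = card B" for A B :: "'n set"
    using finite[of A] that
  proof (induction A arbitrary: B rule: finite_linorder_max_induct)
    case empty
    then have "B = {}" by simp
    then show ?case by (simp add: bij_betw_def)
  next
    case (insert b A)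
    have "b \<notin> A" using insert.hyps by auto
    then have "card B = Suc (card A)" using insert by simp
    then have "B \<noteq> {}" by auto
    then obtain m where m: "m \<in> B" "\<And>x. x \<in> B \<Longrightarrow> y $ m \<le> y $ x"
      using arg_min_if_finite(1)[of B "\<lambda>x. y $ x"] arg_min_least[of B _ "\<lambda>x. y $ x"] finite
      by metis
    have "card A = card (B - {m})" using m \<open>card B = Suc (card A)\<close> by simp
    from insert.IH[OF this] obtain \<sigma> where \<sigma>: "bij_betw \<sigma> A (B - {m})"
      "\<forall>i\<in>A. \<forall>j\<in>A. i \<le> j \<longrightarrow> y $ \<sigma> j \<le> y $ \<sigma> i" by blast
    define \<tau> where "\<tau> = \<sigma>(b := m)"
    have "bij_betw \<tau> A (B - {m})"
      using \<sigma>(1) by (rule bij_betw_cong[THEN iffD1, rotated]) (use \<open>b \<notin> A\<close> in \<open>auto simp: \<tau>_def\<close>)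
    then have bij: "bij_betw \<tau> (insert b A) (insert m (B - {m}))"
      using notIn_Un_bij_betw[of b A \<tau> "B - {m}"] \<open>b \<notin> A\<close> by (simp add: \<tau>_def)
    moreover have "insert m (B - {m}) = B" using m by auto
    moreover have "y $ \<tau> j \<le> y $ \<tau> i" if "i \<in> insert b A" "j \<in> insert b A" "i \<le> j" for i j
    proof (cases "j = b")
      case True
      have "\<tau> i \<in> B" using bij_betwE[OF bij] that(1) m(1) by auto
      then show ?thesis using m True by (simp add: \<tau>_def)
    next
      case False
      then have "j \<in> A" "i \<noteq> b" using that insert.hyps by auto
      then show ?thesis using that \<sigma>(2) False by (auto simp: \<tau>_def)
    qed
    ultimately show ?case by metis
  qed
  from this[of UNIV UNIV]
  have "\<exists>\<sigma> :: 'n \<Rightarrow> 'n. bij \<sigma> \<and> (\<forall>i j. i \<le> j \<longrightarrow> y $ \<sigma> j \<le> y $ \<sigma> i)"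
    by simp
  then show ?thesis using bij_imp_permutes by blast
qed

text \<open>
  The superlevel sets of a decreasing vector are initial segments of the index order, and those of
  a permuted vector have the same size; initial segments of equal size coincide.
\<close>

lemma decreasing_perm_unique:
  fixes y :: "'a::linorder ^ 'n::{finite,linorder}"
  assumes \<sigma>: "\<sigma> permutes UNIV"
    and y: "\<And>i j. i \<le> j \<Longrightarrow> y $ j \<le> y $ i"
    and z: "\<And>i j. i \<le> j \<Longrightarrow> perm_vec y \<sigma> $ j \<le> perm_vec y \<sigma> $ i"
  shows "perm_vec y \<sigma> = y"
proof -
  have level: "{i. t \<le> y $ i} = {i. t \<le> y $ \<sigma> i}" (is "?A = ?B") for t
  proof -
    have "\<sigma> ` ?B = ?A"
      using permutes_surj[OF \<sigma>] by (auto simp: image_iff)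
    then have card: "card ?A = card ?B"
      by (metis card_image inj_on_subset permutes_inj[OF \<sigma>] subset_UNIV)
    have "?A \<subseteq> ?B \<or> ?B \<subseteq> ?A"
    proof (rule ccontr)
      assume "\<not> (?A \<subseteq> ?B \<or> ?B \<subseteq> ?A)"
      then obtain i j where "i \<in> ?A" "i \<notin> ?B" "j \<in> ?B" "j \<notin> ?A" by blast
      then have "\<not> j \<le> i" "\<not> i \<le> j"
        using y[of j i] z[of i j] by (auto dest: order_trans)
      then show False by auto
    qed
    then show ?thesis using card card_subset_eq[of ?A ?B] card_subset_eq[of ?B ?A] by auto
  qed
  have "y $ i = y $ \<sigma> i" for i
    using level[of "y $ i"] level[of "y $ \<sigma> i"] by (auto intro: antisym)
  then show ?thesis by (simp add: vec_eq_iff)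
qed

lemma stab_order_pos: "stab_order y > 0"
proof -
  have "id \<in> {\<sigma>. \<sigma> permutes UNIV \<and> (\<chi> i. y $ \<sigma> i) = y}" by (auto simp: permutes_id)
  then show ?thesis
    unfolding stab_order_def
    by (metis (no_types, lifting) card_gt_0_iff empty_iff finite finite_permutations finite_subset mem_Collect_eq subsetI)
qed

lemma stab_order_real_vec:
  "stab_order (real_vec k) = card {\<sigma>. \<sigma> permutes UNIV \<and> perm_vec k \<sigma> = k}"
  by (simp add: stab_order_def real_vec_def vec_eq_iff)

lemma stab_order_grid_point: "stab_order (grid_point N r) = stab_order (real_vec r)"
proof -
  have "(\<chi> i. grid_point N r $ \<sigma> i) = grid_point N (perm_vec r \<sigma>)" for \<sigma>
    by (simp add: grid_point_def vec_eq_iff)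
  then show ?thesis
    by (simp add: stab_order_real_vec) (simp add: stab_order_def inj_eq[OF inj_grid_point])
qed

text \<open>
  Every fibre of \<open>\<sigma> \<mapsto> k \<circ> \<sigma>\<close> is a coset of the stabilizer of \<open>k\<close>.
\<close>

lemma card_perm_vec_fibre:
  assumes \<tau>: "\<tau> permutes UNIV"
  shows "card {\<sigma>. \<sigma> permutes UNIV \<and> perm_vec k \<sigma> = perm_vec k \<tau>} = stab_order (real_vec k)"
proof -
  have "bij_betw (\<lambda>\<sigma>. \<sigma> \<circ> \<tau>) {\<sigma>. \<sigma> permutes UNIV \<and> perm_vec k \<sigma> = k}
      {\<sigma>. \<sigma> permutes UNIV \<and> perm_vec k \<sigma> = perm_vec k \<tau>}"
  proof (rule bij_betw_byWitness[where f' = "\<lambda>\<sigma>. \<sigma> \<circ> inv \<tau>"])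
    show "\<forall>\<sigma>\<in>{\<sigma>. \<sigma> permutes UNIV \<and> perm_vec k \<sigma> = k}. \<sigma> \<circ> \<tau> \<circ> inv \<tau> = \<sigma>"
      by (simp add: comp_assoc permutes_inv_o[OF \<tau>])
    show "\<forall>\<sigma>\<in>{\<sigma>. \<sigma> permutes UNIV \<and> perm_vec k \<sigma> = perm_vec k \<tau>}. \<sigma> \<circ> inv \<tau> \<circ> \<tau> = \<sigma>"
      by (simp add: comp_assoc permutes_inv_o[OF \<tau>])
    show "(\<lambda>\<sigma>. \<sigma> \<circ> \<tau>) ` {\<sigma>. \<sigma> permutes UNIV \<and> perm_vec k \<sigma> = k}
        \<subseteq> {\<sigma>. \<sigma> permutes UNIV \<and> perm_vec k \<sigma> = perm_vec k \<tau>}"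
      using \<tau> by (auto simp: perm_vec_comp permutes_compose)
    show "(\<lambda>\<sigma>. \<sigma> \<circ> inv \<tau>) ` {\<sigma>. \<sigma> permutes UNIV \<and> perm_vec k \<sigma> = perm_vec k \<tau>}
        \<subseteq> {\<sigma>. \<sigma> permutes UNIV \<and> perm_vec k \<sigma> = k}"
      using \<tau> perm_vec_inv[OF \<tau>, of k "perm_vec k \<tau>"]
      by (auto simp: perm_vec_comp permutes_compose permutes_inv)
  qed
  then show ?thesis by (simp add: stab_order_real_vec bij_betw_same_card)
qed

lemma D_set_eq: "D_set N = vec_lambda ` PiE UNIV (\<lambda>_. {0..int N - 1})"
proof (intro equalityI subsetI)
  fix k :: "int ^ 'n" assume "k \<in> D_set N"
  then have "($) k \<in> PiE UNIV (\<lambda>_. {0..int N - 1})" by (auto simp: D_set_def)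
  then show "k \<in> vec_lambda ` PiE UNIV (\<lambda>_. {0..int N - 1})"
    by (metis image_eqI vec_nth_inverse)
qed (auto simp: D_set_def PiE_iff)

lemma finite_D_set: "finite (D_set N)"
  unfolding D_set_eq by (intro finite_imageI finite_PiE) auto

lemma finite_D_plus: "finite (D_plus N)"
  by (rule finite_subset[OF _ finite_D_set[of N]]) (auto simp: D_plus_def)

lemma perm_vec_D_set: "k \<in> D_set N \<Longrightarrow> perm_vec k \<sigma> \<in> D_set N"
  by (simp add: D_set_def)

lemma D_plus_perm_unique:
  assumes "k \<in> D_plus N" "perm_vec k \<sigma> \<in> D_plus N" "\<sigma> permutes UNIV"
  shows "perm_vec k \<sigma> = k"
  using decreasing_perm_unique[OF assms(3), of k] assms(1,2) by (simp add: D_plus_def)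

lemma D_set_eq_orbits:
  "(D_set N :: (int ^ 'n::{finite,linorder}) set) = (\<Union>k\<in>D_plus N. perm_vec k ` {\<sigma>. \<sigma> permutes UNIV})"
proof (intro equalityI subsetI)
  fix r :: "int ^ 'n::{finite,linorder}" assume r: "r \<in> D_set N"
  obtain \<sigma> where \<sigma>: "\<sigma> permutes UNIV" "\<forall>i j. i \<le> j \<longrightarrow> r $ \<sigma> j \<le> r $ \<sigma> i"
    using ex_perm_decreasing by blast
  then have "perm_vec r \<sigma> \<in> D_plus N" using r by (simp add: D_plus_def perm_vec_D_set)
  moreover have "r = perm_vec (perm_vec r \<sigma>) (inv \<sigma>)"
    using perm_vec_inv[OF \<sigma>(1), of r "perm_vec r \<sigma>"] by simp
  moreover have "inv \<sigma> permutes UNIV" using \<sigma> by (simp add: permutes_inv)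
  ultimately show "r \<in> (\<Union>k\<in>D_plus N. perm_vec k ` {\<sigma>. \<sigma> permutes UNIV})" by blast
qed (auto simp: D_plus_def perm_vec_D_set)

lemma orbits_disjoint:
  assumes "k \<in> D_plus N" "l \<in> D_plus N" "\<sigma> permutes UNIV" "\<tau> permutes UNIV"
    and "perm_vec k \<sigma> = perm_vec l \<tau>"
  shows "k = l"
proof -
  have "k = perm_vec l (\<tau> \<circ> inv \<sigma>)"
    using perm_vec_inv[OF assms(3), THEN iffD1, OF assms(5)] by (simp only: perm_vec_comp)
  moreover have "\<tau> \<circ> inv \<sigma> permutes UNIV"
    using assms by (simp add: permutes_compose permutes_inv)
  ultimately show ?thesis using D_plus_perm_unique[of l N "\<tau> \<circ> inv \<sigma>"] assms by simp
qed

text \<open>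
  Orbit-stabilizer: summing over the cube orbit by orbit, each decreasing vector represents
  \<open>n! / H\<^sub>k\<close> points, on all of which \<open>g\<close> takes the same value.
\<close>

lemma sum_D_set_symmetric:
  fixes g :: "int ^ 'n::{finite,linorder} \<Rightarrow> real"
  assumes g: "\<And>k \<sigma>. \<sigma> permutes UNIV \<Longrightarrow> g (perm_vec k \<sigma>) = g k"
  shows "(\<Sum>k\<in>D_set N. g k)
    = fact CARD('n) * (\<Sum>k\<in>D_plus N. inverse (real (stab_order (real_vec k))) * g k)"
proof -
  let ?P = "{\<sigma> :: 'n \<Rightarrow> 'n. \<sigma> permutes UNIV}"
  have fin: "finite ?P" by (simp add: finite_permutations)
  have orbit: "(\<Sum>r\<in>perm_vec k ` ?P. g r)
      = fact CARD('n) * (inverse (real (stab_order (real_vec k))) * g k)" for k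
  proof -
    \<comment> \<open>double counting of the permutations, sorted by the vector to which they send \<open>k\<close>\<close>
    have "fact CARD('n) = (\<Sum>\<sigma>\<in>?P. (1::real))"
      by (simp add: card_permutations[OF refl])
    also have "\<dots> = (\<Sum>r\<in>perm_vec k ` ?P. \<Sum>\<sigma> | \<sigma> \<in> ?P \<and> perm_vec k \<sigma> = r. 1)"
      by (rule sum.image_gen[OF fin])
    also have "\<dots> = real (card (perm_vec k ` ?P)) * real (stab_order (real_vec k))"
    proof -
      have "(\<Sum>\<sigma> | \<sigma> \<in> ?P \<and> perm_vec k \<sigma> = r. 1) = real (stab_order (real_vec k))"
        if "r \<in> perm_vec k ` ?P" for r
        using that by (auto simp: card_perm_vec_fibre)
      then show ?thesis by simp
    qed
    finally have "real (card (perm_vec k ` ?P))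
        = fact CARD('n) * inverse (real (stab_order (real_vec k)))"
      using stab_order_pos[of "real_vec k"] by (simp add: field_simps)
    moreover have "(\<Sum>r\<in>perm_vec k ` ?P. g r) = (\<Sum>r\<in>perm_vec k ` ?P. g k)"
      by (rule sum.cong) (auto simp: g)
    ultimately show ?thesis by simp
  qed
  have "(\<Sum>k\<in>D_set N. g k) = (\<Sum>k\<in>D_plus N. \<Sum>r\<in>perm_vec k ` ?P. g r)"
    unfolding D_set_eq_orbits
    by (rule sum.UNION_disjoint)
      (use fin finite_D_plus in \<open>auto dest: orbits_disjoint\<close>)
  then show ?thesis by (simp add: orbit sum_distrib_left)
qed

section \<open>The symmetrized kernel\<close>

definition sym_kernel :: "nat \<Rightarrow> int ^ 'n \<Rightarrow> int ^ 'n \<Rightarrow> real" where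
  "sym_kernel N k r = (\<Sum>\<sigma> | \<sigma> permutes UNIV. \<Prod>i\<in>UNIV. dct_kernel N (k $ \<sigma> i) (r $ i))"

lemma cos_plus_grid_point: "cos_plus (real_vec k) (grid_point N r) = sym_kernel N k r"
  by (simp add: cos_plus_def sym_kernel_def dct_kernel_def real_vec_def grid_point_def mult_ac)

lemma prod_perm_UNIV:
  assumes "\<tau> permutes UNIV"
  shows "(\<Prod>i\<in>UNIV. h (\<tau> i)) = (\<Prod>i\<in>UNIV. h i)"
  using prod.permute[OF assms, of h] by (simp add: comp_def)

lemma sym_kernel_perm:
  assumes \<tau>: "\<tau> permutes UNIV"
  shows "sym_kernel N (perm_vec k \<tau>) r = sym_kernel N k r"
proof -
  have "sym_kernel N k r
      = (\<Sum>\<sigma> | \<sigma> permutes UNIV. \<Prod>i\<in>UNIV. dct_kernel N (k $ (\<tau> \<circ> \<sigma>) i) (r $ i))"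
    unfolding sym_kernel_def by (rule setum_permutations_compose_left[OF \<tau>])
  then show ?thesis by (simp add: sym_kernel_def)
qed

text \<open>
  Replacing \<open>\<sigma>\<close> by its inverse moves the permutation from one argument to the other.
\<close>

lemma sym_kernel_commute: "sym_kernel N k r = sym_kernel N r k"
proof -
  have "sym_kernel N k r
      = (\<Sum>\<sigma> | \<sigma> permutes UNIV. \<Prod>i\<in>UNIV. dct_kernel N (k $ inv \<sigma> i) (r $ i))"
    unfolding sym_kernel_def by (rule sum_permutations_inverse)
  also have "\<dots> = (\<Sum>\<sigma> | \<sigma> permutes UNIV. \<Prod>i\<in>UNIV. dct_kernel N (r $ \<sigma> i) (k $ i))"
  proof (rule sum.cong[OF refl])
    fix \<sigma> :: "'a \<Rightarrow> 'a" assume "\<sigma> \<in> {\<sigma>. \<sigma> permutes UNIV}"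
    then have \<sigma>: "\<sigma> permutes UNIV" by simp
    show "(\<Prod>i\<in>UNIV. dct_kernel N (k $ inv \<sigma> i) (r $ i))
        = (\<Prod>i\<in>UNIV. dct_kernel N (r $ \<sigma> i) (k $ i))"
      using prod_perm_UNIV[OF \<sigma>, of "\<lambda>i. dct_kernel N (k $ inv \<sigma> i) (r $ i)"]
      by (simp add: permutes_inverses[OF \<sigma>] dct_kernel_commute)
  qed
  finally show ?thesis by (simp add: sym_kernel_def)
qed

lemma d_weight_perm:
  assumes "\<sigma> permutes UNIV"
  shows "d_weight N (perm_vec k \<sigma>) = d_weight N k"
  unfolding d_weight_def
  using prod_perm_UNIV[OF assms, of "\<lambda>i. c_weight N (k $ i)"] by simp

lemma sum_D_set_prod:
  fixes h :: "'n::finite \<Rightarrow> int \<Rightarrow> real"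
  shows "(\<Sum>r\<in>D_set N. \<Prod>i\<in>UNIV. h i (r $ i)) = (\<Prod>i\<in>UNIV. \<Sum>a\<in>{0..int N - 1}. h i a)"
proof -
  have "inj_on vec_lambda (PiE (UNIV :: 'n set) (\<lambda>_. {0..int N - 1}))"
    by (rule inj_onI) (metis vec_lambda_inverse UNIV_I)
  then have "(\<Sum>r\<in>D_set N. \<Prod>i\<in>UNIV. h i (r $ i))
      = (\<Sum>g\<in>PiE UNIV (\<lambda>_. {0..int N - 1}). \<Prod>i\<in>UNIV. h i (g i))"
    unfolding D_set_eq by (simp add: sum.reindex)
  then show ?thesis by (simp add: prod_sum_PiE)
qed

text \<open>
  All factors of the summand depend on a single coordinate of \<open>r\<close>, so the sum over the cube is a
  product of one-dimensional sums.
\<close>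

lemma prod_kernel_orthogonal:
  fixes k l :: "int ^ 'n::finite"
  assumes N: "N > 0" and k: "k \<in> D_set N" and l: "l \<in> D_set N"
  shows "(\<Sum>r\<in>D_set N. d_weight N r *
      ((\<Prod>i\<in>UNIV. dct_kernel N (k $ i) (r $ i)) * (\<Prod>i\<in>UNIV. dct_kernel N (l $ i) (r $ i))))
    = (if k = l then ((2 * real N - 1) / 4) ^ CARD('n) / d_weight N k else 0)" (is "?L = ?R")
proof -
  have "?L = (\<Prod>i\<in>UNIV. \<Sum>a\<in>{0..int N - 1}.
      c_weight N a * (dct_kernel N (k $ i) a * dct_kernel N (l $ i) a))"
    using sum_D_set_prod[where N = N and h = "\<lambda>i a.
      c_weight N a * (dct_kernel N (k $ i) a * dct_kernel N (l $ i) a)"]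
    by (simp only: d_weight_def prod.distrib[symmetric])
  also have "\<dots> = (\<Prod>i\<in>UNIV.
      if k $ i = l $ i then (2 * real N - 1) / 4 / c_weight N (k $ i) else 0)"
    by (intro prod.cong refl dct_kernel_orthogonal[OF N]) (use k l in \<open>auto simp: D_set_def\<close>)
  also have "\<dots> = ?R"
  proof (cases "k = l")
    case True
    then show ?thesis
      by (simp only: d_weight_def prod_dividef prod_constant power_divide simp_thms if_True)
  next
    case False
    then show ?thesis by (auto simp: vec_eq_iff)
  qed
  finally show ?thesis .
qed

text \<open>
  The relation is proved after multiplication by \<open>n!\<close>, which turns the left-hand side into a
  sum over the whole cube. There the summation over \<open>\<sigma>\<close> contributes one stabilizer order and the
  summation over \<open>\<tau>\<close> contributes \<open>n!\<close>, which cancels.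
\<close>

lemma sym_kernel_orthogonal:
  fixes k l :: "int ^ 'n::{finite,linorder}"
  assumes N: "N > 0" and k: "k \<in> D_plus N" and l: "l \<in> D_plus N"
  shows "(\<Sum>r\<in>D_plus N. d_weight N r * inverse (real (stab_order (real_vec r))) *
      sym_kernel N k r * sym_kernel N l r)
    = real (stab_order (real_vec k)) / d_weight N k * ((2 * real N - 1) / 4) ^ CARD('n) *
      (if k = l then 1 else 0)" (is "?L = ?R")
proof -
  let ?P = "{\<sigma> :: 'n \<Rightarrow> 'n. \<sigma> permutes UNIV}"
  let ?K = "((2 * real N - 1) / 4) ^ CARD('n)"
  let ?F = "\<lambda>k \<sigma> r. \<Prod>i\<in>UNIV. dct_kernel N (perm_vec k \<sigma> $ i) (r $ i)"
  have kD: "k \<in> D_set N" and lD: "l \<in> D_set N" using k l by (auto simp: D_plus_def)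
  have fin: "finite ?P" by (simp add: finite_permutations)
  have "fact CARD('n) * ?L = (\<Sum>r\<in>D_set N. d_weight N r * (sym_kernel N k r * sym_kernel N l r))"
    by (subst sum_D_set_symmetric)
      (simp_all add: d_weight_perm sym_kernel_perm sym_kernel_commute[of N _ "perm_vec _ _"]
        sym_kernel_commute[of N k] sym_kernel_commute[of N l] mult_ac)
  also have "\<dots> = (\<Sum>r\<in>D_set N. \<Sum>\<tau>\<in>?P. \<Sum>\<sigma>\<in>?P. d_weight N r * (?F k \<sigma> r * ?F l \<tau> r))"
  proof (rule sum.cong[OF refl])
    fix r
    have "sym_kernel N k r * sym_kernel N l r = (\<Sum>\<tau>\<in>?P. \<Sum>\<sigma>\<in>?P. ?F k \<sigma> r * ?F l \<tau> r)"
      by (simp add: sym_kernel_def sum_product) (rule sum.swap)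
    then show "d_weight N r * (sym_kernel N k r * sym_kernel N l r)
        = (\<Sum>\<tau>\<in>?P. \<Sum>\<sigma>\<in>?P. d_weight N r * (?F k \<sigma> r * ?F l \<tau> r))"
      by (simp only: sum_distrib_left)
  qed
  also have "\<dots> = (\<Sum>\<tau>\<in>?P. \<Sum>r\<in>D_set N. \<Sum>\<sigma>\<in>?P. d_weight N r * (?F k \<sigma> r * ?F l \<tau> r))"
    by (rule sum.swap)
  also have "\<dots> = (\<Sum>\<tau>\<in>?P. \<Sum>\<sigma>\<in>?P. \<Sum>r\<in>D_set N. d_weight N r * (?F k \<sigma> r * ?F l \<tau> r))"
    by (intro sum.cong refl sum.swap)
  also have "\<dots> = (\<Sum>\<tau>\<in>?P. \<Sum>\<sigma>\<in>?P.
      if perm_vec k \<sigma> = perm_vec l \<tau> then ?K / d_weight N k else 0)"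
  proof (intro sum.cong refl)
    fix \<tau> \<sigma> assume "\<sigma> \<in> ?P"
    then show "(\<Sum>r\<in>D_set N. d_weight N r * (?F k \<sigma> r * ?F l \<tau> r))
        = (if perm_vec k \<sigma> = perm_vec l \<tau> then ?K / d_weight N k else 0)"
      using prod_kernel_orthogonal[OF N perm_vec_D_set[OF kD] perm_vec_D_set[OF lD], of \<sigma> \<tau>]
        d_weight_perm[of \<sigma> N k] by (simp only: mem_Collect_eq)
  qed
  also have "\<dots> = (\<Sum>\<tau>\<in>?P. real (card {\<sigma>. \<sigma> permutes UNIV \<and> perm_vec k \<sigma> = perm_vec l \<tau>})
      * (?K / d_weight N k))"
    by (simp add: sum.If_cases[OF fin] Int_def)
  also have "\<dots> = (\<Sum>\<tau>\<in>?P. ?R)"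
  proof (rule sum.cong[OF refl])
    fix \<tau> assume "\<tau> \<in> ?P"
    then have \<tau>: "\<tau> permutes UNIV" by simp
    show "real (card {\<sigma>. \<sigma> permutes UNIV \<and> perm_vec k \<sigma> = perm_vec l \<tau>}) * (?K / d_weight N k) = ?R"
    proof (cases "k = l")
      case True
      then show ?thesis by (simp add: card_perm_vec_fibre[OF \<tau>])
    next
      case False
      then have "{\<sigma>. \<sigma> permutes UNIV \<and> perm_vec k \<sigma> = perm_vec l \<tau>} = {}"
        using orbits_disjoint[OF k l _ \<tau>] by blast
      then show ?thesis using False by simp
    qed
  qed
  also have "\<dots> = fact CARD('n) * ?R" by (simp add: card_permutations[OF refl])
  finally show ?thesis using mult_left_cancel[OF fact_nonzero] by blast
qed

section \<open>Discrete orthogonality and expansion\<close>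

lemma sum_F_plus:
  "(\<Sum>s\<in>F_plus N. h s) = (\<Sum>r\<in>D_plus N. h (grid_point N r))"
  unfolding F_plus_def by (simp add: sum.reindex inj_on_subset[OF inj_grid_point])

lemma eps_weight_grid: "r \<in> D_plus N \<Longrightarrow> eps_weight N (grid_point N r) = d_weight N r"
  by (simp add: eps_weight_grid_point d_weight_def)

theorem mainTheorem5:
  fixes N :: nat
  assumes "N > 0"
  shows
    "(\<forall>k \<in> (D_plus N :: (int ^ 'n::{finite,linorder}) set). \<forall>k' \<in> D_plus N.
        (\<Sum>s\<in>F_plus N. eps_weight N s * inverse (real (stab_order s)) *
            cos_plus (real_vec k) s * cos_plus (real_vec k') s)
        = real (stab_order (real_vec k)) / d_weight N k * ((2 * real N - 1) / 4) ^ CARD('n) *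
            (if k = k' then 1 else 0)) \<and>
     (\<forall>f :: real ^ 'n::{finite,linorder} \<Rightarrow> real. \<forall>s \<in> F_plus N.
        f s = (\<Sum>k\<in>D_plus N. expansion_coeff N f k * cos_plus (real_vec k) s))"
proof (intro conjI ballI allI)
  fix k k' :: "int ^ 'n::{finite,linorder}"
  assume k: "k \<in> D_plus N" "k' \<in> D_plus N"
  show "(\<Sum>s\<in>F_plus N. eps_weight N s * inverse (real (stab_order s)) *
            cos_plus (real_vec k) s * cos_plus (real_vec k') s)
        = real (stab_order (real_vec k)) / d_weight N k * ((2 * real N - 1) / 4) ^ CARD('n) *
            (if k = k' then 1 else 0)"
    unfolding sym_kernel_orthogonal[OF assms k, symmetric] sum_F_plus
    by (intro sum.cong refl) (simp add: eps_weight_grid stab_order_grid_point cos_plus_grid_point)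
next
  fix f :: "real ^ 'n::{finite,linorder} \<Rightarrow> real" and s :: "real ^ 'n::{finite,linorder}"
  assume "s \<in> F_plus N"
  then obtain q where q: "q \<in> D_plus N" "s = grid_point N q" by (auto simp: F_plus_def)
  define M where "M = ((2 * real N - 1) / 4) ^ CARD('n)"
  let ?H = "\<lambda>k :: int ^ 'n::{finite,linorder}. real (stab_order (real_vec k))"
  let ?w = "\<lambda>k. d_weight N k * inverse (?H k)"
  have M: "M \<noteq> 0" using assms by (simp add: M_def field_simps)
  have w: "?w r \<noteq> 0" for r
    using stab_order_pos[of "real_vec r"] by (simp add: d_weight_def c_weight_def)
  have coeff: "expansion_coeff N f k
      = inverse (M) * (\<Sum>r\<in>D_plus N. ?w k * ?w r * f (grid_point N r) * sym_kernel N k r)" for k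
  proof -
    have const: "(4 / (2 * real N - 1)) ^ CARD('n) = inverse (M)"
      by (simp only: M_def power_inverse[symmetric] inverse_divide)
    show ?thesis
      unfolding expansion_coeff_def sum_F_plus const sum_distrib_left
      by (intro sum.cong refl)
        (simp only: eps_weight_grid stab_order_grid_point cos_plus_grid_point divide_inverse mult_ac)
  qed
  have "(\<Sum>k\<in>D_plus N. expansion_coeff N f k * cos_plus (real_vec k) s)
      = inverse (M) * (\<Sum>k\<in>D_plus N. \<Sum>r\<in>D_plus N.
          ?w r * f (grid_point N r) * (?w k * sym_kernel N r k * sym_kernel N q k))"
    unfolding coeff q cos_plus_grid_point sum_distrib_left sum_distrib_right
  proof (intro sum.cong refl)
    fix k r
    show "inverse (M) * (?w k * ?w r * f (grid_point N r) * sym_kernel N k r)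
          * sym_kernel N k q
        = inverse (M) * (?w r * f (grid_point N r)
          * (?w k * sym_kernel N r k * sym_kernel N q k))"
      by (simp only: sym_kernel_commute[of N k r] sym_kernel_commute[of N k q] mult_ac)
  qed
  also have "\<dots> = inverse (M) * (\<Sum>r\<in>D_plus N.
          ?w r * f (grid_point N r) * (\<Sum>k\<in>D_plus N. ?w k * sym_kernel N r k * sym_kernel N q k))"
    by (subst sum.swap) (simp only: sum_distrib_left)
  also have "\<dots> = inverse (M) * (\<Sum>r\<in>D_plus N. if r = q then f s * M else 0)"
  proof (intro arg_cong2[where f = "(*)"] refl sum.cong)
    fix r :: "int ^ 'n::{finite,linorder}" assume r: "r \<in> D_plus N"
    \<comment> \<open>the dual relation: by symmetry the nodes \<open>r\<close> and \<open>q\<close> now act as frequencies\<close>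
    have "(\<Sum>k\<in>D_plus N. ?w k * sym_kernel N r k * sym_kernel N q k)
        = (if r = q then M / ?w r else 0)"
      unfolding sym_kernel_orthogonal[OF assms r q(1)] M_def[symmetric]
      by (cases "r = q") (simp_all add: divide_inverse)
    then show "?w r * f (grid_point N r) * (\<Sum>k\<in>D_plus N. ?w k * sym_kernel N r k * sym_kernel N q k)
        = (if r = q then f s * M else 0)"
      using w[of r] by (cases "r = q") (simp_all only: q(2) if_True if_False, simp_all)
  qed
  also have "\<dots> = f s"
    using q(1) M by (simp add: sum.delta[OF finite_D_plus])
  finally show "f s = (\<Sum>k\<in>D_plus N. expansion_coeff N f k * cos_plus (real_vec k) s)" by simp
qed

end
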